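(* Let $n\geq 7$ be an integer and let $G$ be an edge-colored $K^{(3)}_n$ containing no rainbow copy of the loose path $\mathcal{L}$, with $|C(G)|\geq 3$. Then at least one of the following holds: (i) there exists a vertex $u\in V(G)$ such that $G-u$ is monochromatic; (ii) there exist an edge $e\in E(G)$ and a color $i\in C(G)$ with $c(e)\neq i$ such that every edge $f\in E(G)\setminus\{e\}$ with $c(f)\neq i$ satisfies $|f\cap e|=2$.
   Context: An edge-coloring of a hypergraph $G$ is any map $c:E(G)\to\mathbb{N}$; $C(G)=\{c(e):e\in E(G)\}$. A copy of $H$ in $G$ is a subhypergraph isomorphic to $H$; it is rainbow if its edges have pairwise distinct colors; a hypergraph is monochromatic if all its edges have the same color. For a vertex $u$, $G-u$ is the subhypergraph induced by $V(G)\setminus\{u\}$. $K^{(3)}_n$ is the complete 3-uniform hypergraph on $n$ vertices. The loose path $\mathcal{L}$ is the 3-graph with vertices $v_1,\ldots,v_7$ and edges $\{v_1v_2v_3, v_3v_4v_5, v_5v_6v_7\}$. *)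

theory Defs
  imports Main
begin

type_synonym 'a hypergraph = "'a set \<times> 'a set set"

abbreviation verts :: "'a hypergraph \<Rightarrow> 'a set" where
  "verts G \<equiv> fst G"

abbreviation edges :: "'a hypergraph \<Rightarrow> 'a set set" where
  "edges G \<equiv> snd G"

definition hypergraph :: "'a hypergraph \<Rightarrow> bool" where
  "hypergraph G \<longleftrightarrow> (\<forall>e \<in> edges G. e \<subseteq> verts G)"

definition subhypergraph :: "'a hypergraph \<Rightarrow> 'a hypergraph \<Rightarrow> bool" where
  "subhypergraph H G \<longleftrightarrow> hypergraph H \<and> verts H \<subseteq> verts G \<and> edges H \<subseteq> edges G"

definition isomorphic :: "'a hypergraph \<Rightarrow> 'b hypergraph \<Rightarrow> bool" where
  "isomorphic H K \<longleftrightarrow>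
     (\<exists>\<phi>. bij_betw \<phi> (verts H) (verts K) \<and> edges K = (\<lambda>e. \<phi> ` e) ` edges H)"

definition is_copy :: "'b hypergraph \<Rightarrow> 'a hypergraph \<Rightarrow> 'a hypergraph \<Rightarrow> bool" where
  "is_copy H K G \<longleftrightarrow> subhypergraph K G \<and> isomorphic H K"

definition induced :: "'a hypergraph \<Rightarrow> 'a set \<Rightarrow> 'a hypergraph" where
  "induced G W = (W, {e \<in> edges G. e \<subseteq> W})"

definition delete_vertex :: "'a hypergraph \<Rightarrow> 'a \<Rightarrow> 'a hypergraph" where
  "delete_vertex G u = induced G (verts G - {u})"

definition complete_hypergraph :: "nat \<Rightarrow> 'a set \<Rightarrow> 'a hypergraph" where
  "complete_hypergraph k V = (V, {e. e \<subseteq> V \<and> card e = k})"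

definition loose_path :: "nat hypergraph" where
  "loose_path = ({1..7}, {{1, 2, 3}, {3, 4, 5}, {5, 6, 7}})"

text \<open>A colouring is a total function on vertex sets; all notions below depend only on
  its values on the edges of the hypergraph at hand.\<close>

definition colors :: "('a set \<Rightarrow> nat) \<Rightarrow> 'a hypergraph \<Rightarrow> nat set" where
  "colors c G = c ` edges G"

definition rainbow :: "('a set \<Rightarrow> nat) \<Rightarrow> 'a hypergraph \<Rightarrow> bool" where
  "rainbow c H \<longleftrightarrow> inj_on c (edges H)"

definition monochromatic :: "('a set \<Rightarrow> nat) \<Rightarrow> 'a hypergraph \<Rightarrow> bool" where
  "monochromatic c H \<longleftrightarrow> (\<forall>e \<in> edges H. \<forall>f \<in> edges H. c e = c f)"

end

theory Submission
  imports Defs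
begin

text \<open>
  Say that two edges are close if they share two vertices. A few explicit paths show that no three
  edges of distinct colours are pairwise non-close. Now suppose that edges \<open>f\<close>, \<open>g\<close> are close
  while \<open>e\<close> is close to neither, all three of distinct colours. The absence of such a triple spreads
  the colour \<open>i\<close> of \<open>e\<close> to every edge with at least two vertices outside \<open>f \<union> g\<close>. Hence every edge of
  a colour other than \<open>i\<close> meets a triple disjoint from \<open>f \<union> g\<close> in at most one vertex, and, once
  more because of the missing triple, any two edges of distinct colours other than \<open>i\<close> are close.
  So the colour classes other than \<open>i\<close> are pairwise cross 2-intersecting. If \<open>p\<close>, \<open>q\<close> are non-close
  edges of one such class, every edge of the other classes contains their common vertex \<open>a\<close>; if
  every edge has a non-close partner, applying this twice puts \<open>a\<close> in all edges of colour other
  than \<open>i\<close>, and otherwise an edge without a partner is close to all of them.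
\<close>

section \<open>Three-element sets\<close>

lemma card_3_obtain_rest:
  assumes "card e = 3" "r \<in> e"
  obtains p q where "e = {p, q, r}" "p \<noteq> q" "p \<noteq> r" "q \<noteq> r"
proof -
  have "finite e" using assms(1) card.infinite by force
  then have "card (e - {r}) = 2" using assms by simp
  then obtain p q where "e - {r} = {p, q}" "p \<noteq> q" by (auto simp: card_2_iff)
  then show thesis using assms(2) that[of p q] by blast
qed

text \<open>Pigeonhole: two disjoint pairs do not fit into three vertices. This is what later
  produces a common vertex of three edges.\<close>

lemma two_pairs_in_triple_meet:
  assumes "card r = 3" "card (r \<inter> p) \<ge> 2" "card (r \<inter> q) \<ge> 2"
  shows "r \<inter> p \<inter> q \<noteq> {}"
proof
  assume empty: "r \<inter> p \<inter> q = {}"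
  have "finite r" using assms(1) card.infinite by force
  then have "card (r \<inter> p) + card (r \<inter> q) = card ((r \<inter> p) \<union> (r \<inter> q))"
    using empty by (subst card_Un_disjoint) auto
  also have "\<dots> \<le> 3" using card_mono[of r "(r \<inter> p) \<union> (r \<inter> q)"] \<open>finite r\<close> assms(1) by auto
  finally show False using assms by simp
qed

lemma card_3_obtain_third:
  assumes "card e = 3" "p \<in> e" "r \<in> e" "p \<noteq> r"
  obtains q where "e = {p, q, r}" "q \<noteq> p" "q \<noteq> r"
proof -
  obtain s t where "e = {s, t, r}" "s \<noteq> t" "s \<noteq> r" "t \<noteq> r"
    using card_3_obtain_rest[OF assms(1,3)] .
  then show thesis using assms(2,4) that[of s] that[of t] by (auto simp: insert_commute)
qed

section \<open>The hypothesis at the level of vertices\<close>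

text \<open>Listing seven vertices in path order makes every use of \<open>path_free\<close> an
  explicit path, with \<open>r\<close> and \<open>t\<close> as the two joints.\<close>

locale rainbow_loose_path_free =
  fixes V :: "'a set" and c :: "'a set \<Rightarrow> nat"
  assumes finite_V: "finite V" and card_V: "7 \<le> card V"
    and path_free: "\<And>p q r s t u v. \<lbrakk>distinct [p, q, r, s, t, u, v]; {p, q, r, s, t, u, v} \<subseteq> V\<rbrakk>
      \<Longrightarrow> c {p, q, r} = c {r, s, t} \<or> c {r, s, t} = c {t, u, v} \<or> c {p, q, r} = c {t, u, v}"
begin

definition E :: "'a set set" where
  "E = {e. e \<subseteq> V \<and> card e = 3}"

lemma obtain_outside:
  assumes "length xs < 7"
  obtains w where "w \<in> V" "w \<notin> set xs"
proof -
  have "\<not> V \<subseteq> set xs"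
    using card_mono[of "set xs" V] card_length[of xs] assms card_V by auto
  then show thesis using that by blast
qed

section \<open>Triples of pairwise non-close edges of distinct colours\<close>

text \<open>The transversal \<open>{a1, b1, d1}\<close> links any two of the three edges into a
  loose path, so its colour would have to occur in every two of the three colours.\<close>

lemma no_rainbow_disjoint_triple:
  assumes d: "distinct [a1, a2, a3, b1, b2, b3, d1, d2, d3]"
    and V: "{a1, a2, a3, b1, b2, b3, d1, d2, d3} \<subseteq> V"
    and c: "c {a1, a2, a3} \<noteq> c {b1, b2, b3}" "c {a1, a2, a3} \<noteq> c {d1, d2, d3}"
      "c {b1, b2, b3} \<noteq> c {d1, d2, d3}"
  shows False
  using path_free[of a2 a3 a1 d1 b1 b2 b3] path_free[of a2 a3 a1 b1 d1 d2 d3]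
    path_free[of b2 b3 b1 a1 d1 d2 d3] d V c
  by (simp add: insert_commute) argo

lemma no_rainbow_pair_and_disjoint:
  assumes d: "distinct [v1, v2, v3, v4, v5, v6, v7, v8]"
    and V: "{v1, v2, v3, v4, v5, v6, v7, v8} \<subseteq> V"
    and c: "c {v1, v2, v3} \<noteq> c {v3, v4, v5}" "c {v1, v2, v3} \<noteq> c {v6, v7, v8}"
      "c {v3, v4, v5} \<noteq> c {v6, v7, v8}"
  shows False
proof -
  \<comment> \<open>The edge \<open>{v1, v4, v6}\<close> links \<open>{v6, v7, v8}\<close> to either
    of the other two edges, which leaves only the colour of \<open>{v6, v7, v8}\<close>; the same
    holds with \<open>v7\<close> as the joint.\<close>
  have 1: "c {v1, v4, v6} = c {v6, v7, v8}"
    using path_free[of v2 v3 v1 v4 v6 v7 v8] path_free[of v3 v5 v4 v1 v6 v7 v8] d V c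
    by (simp add: insert_commute) argo
  have 2: "c {v1, v4, v7} = c {v6, v7, v8}"
    using path_free[of v2 v3 v1 v4 v7 v6 v8] path_free[of v3 v5 v4 v1 v7 v6 v8] d V c
    by (simp add: insert_commute) argo
  have 3: "c {v2, v7, v8} = c {v1, v2, v3}"
    using path_free[of v7 v8 v2 v1 v3 v4 v5] path_free[of v7 v8 v2 v3 v1 v4 v6] 1 d V c
    by (simp add: insert_commute) argo
  show False
    using path_free[of v2 v8 v7 v1 v4 v3 v5] 2 3 d V c
    by (simp add: insert_commute) argo
qed

lemma no_rainbow_triangle:
  assumes d: "distinct [v1, v2, v3, v4, v5, v6, v7]"
    and V: "{v1, v2, v3, v4, v5, v6, v7} \<subseteq> V"
    and c: "c {v1, v2, v3} \<noteq> c {v3, v4, v5}" "c {v1, v2, v3} \<noteq> c {v1, v5, v6}"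
      "c {v3, v4, v5} \<noteq> c {v1, v5, v6}"
  shows False
proof -
  \<comment> \<open>Two of the vertices \<open>v2\<close>, \<open>v4\<close>, \<open>v6\<close> of
    degree one, together with the spare vertex \<open>v7\<close>, receive the colour of the triangle
    edge disjoint from them.\<close>
  have 267: "c {v2, v6, v7} = c {v3, v4, v5}"
    using path_free[of v6 v7 v2 v1 v3 v4 v5] path_free[of v2 v7 v6 v1 v5 v3 v4] d V c
    by (simp add: insert_commute) argo
  have 247: "c {v2, v4, v7} = c {v1, v5, v6}"
    using path_free[of v4 v7 v2 v3 v1 v5 v6] path_free[of v2 v7 v4 v3 v5 v1 v6] d V c
    by (simp add: insert_commute) argo
  have 467: "c {v4, v6, v7} = c {v1, v2, v3}"
    using path_free[of v6 v7 v4 v5 v3 v1 v2] path_free[of v4 v7 v6 v5 v1 v2 v3] d V c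
    by (simp add: insert_commute) argo
  \<comment> \<open>The same holds when \<open>v7\<close> is replaced by the corner between the two
    vertices of degree one.\<close>
  have 126: "c {v1, v2, v6} = c {v3, v4, v5}"
    using path_free[of v1 v2 v6 v7 v4 v3 v5] path_free[of v1 v6 v2 v7 v4 v3 v5] 467 247 d V c
    by (simp add: insert_commute) argo
  have 234: "c {v2, v3, v4} = c {v1, v5, v6}"
    using path_free[of v2 v3 v4 v7 v6 v1 v5] path_free[of v3 v4 v2 v7 v6 v1 v5] 467 267 d V c
    by (simp add: insert_commute) argo
  have 456: "c {v4, v5, v6} = c {v1, v2, v3}"
    using path_free[of v4 v5 v6 v7 v2 v1 v3] path_free[of v5 v6 v4 v7 v2 v1 v3] 267 247 d V c
    by (simp add: insert_commute) argo
  \<comment> \<open>Putting \<open>v7\<close> in place of a corner in two triangle edges keeps their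
    colours but makes them meet in \<open>v7\<close>, so that the triangle opens into a rainbow
    path.\<close>
  have 347: "c {v3, v4, v7} = c {v3, v4, v5}"
    using path_free[of v3 v7 v4 v5 v6 v1 v2] path_free[of v3 v4 v7 v2 v6 v1 v5] 456 126 267 d V c
    by (simp add: insert_commute) argo
  have 127: "c {v1, v2, v7} = c {v1, v2, v3}"
    using path_free[of v1 v7 v2 v3 v4 v5 v6] path_free[of v1 v2 v7 v6 v4 v3 v5] 456 234 467 d V c
    by (simp add: insert_commute) argo
  show False
    using path_free[of v5 v6 v1 v2 v7 v3 v4] 127 347 d V c
    by (simp add: insert_commute) argo
qed

text \<open>The path through \<open>{a1, d1, d2}\<close>, \<open>{z, a1, a2}\<close>,
  \<open>{z, b1, b2}\<close> leaves two colours. If the edge had that of \<open>{z, a1, a2}\<close>,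
  further colours would be forced, ending in a rainbow path.\<close>

lemma sunflower_forced_color:
  assumes d: "distinct [z, a1, a2, b1, b2, d1, d2]"
    and V: "{z, a1, a2, b1, b2, d1, d2} \<subseteq> V"
    and c: "c {z, a1, a2} \<noteq> c {z, b1, b2}" "c {z, a1, a2} \<noteq> c {z, d1, d2}"
      "c {z, b1, b2} \<noteq> c {z, d1, d2}"
  shows "c {a1, d1, d2} = c {z, b1, b2}"
proof (rule ccontr)
  assume n: "c {a1, d1, d2} \<noteq> c {z, b1, b2}"
  have 1: "c {a1, d1, d2} = c {z, a1, a2}"
    using path_free[of d1 d2 a1 a2 z b1 b2] n d V c by (simp add: insert_commute) argo
  have 2: "c {a1, a2, b1} = c {z, b1, b2}"
    using path_free[of d1 d2 a1 a2 b1 z b2] path_free[of a1 a2 b1 b2 z d1 d2] 1 d V c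
    by (simp add: insert_commute) argo
  have 3: "c {a1, a2, b2} = c {z, b1, b2}"
    using path_free[of d1 d2 a1 a2 b2 z b1] path_free[of a1 a2 b2 b1 z d1 d2] 1 d V c
    by (simp add: insert_commute) argo
  have 4: "c {b1, b2, d1} = c {z, d1, d2}"
    using path_free[of a1 a2 b1 b2 d1 z d2] path_free[of b1 b2 d1 d2 z a1 a2] 2 d V c
    by (simp add: insert_commute) argo
  have 5: "c {a2, b1, d2} = c {z, b1, b2}"
    using path_free[of a1 d1 d2 a2 b1 z b2] path_free[of a1 b2 a2 b1 d2 z d1] 1 3 d V c
    by (simp add: insert_commute) argo
  show False
    using path_free[of b2 d1 b1 d2 a2 z a1] 4 5 d V c
    by (simp add: insert_commute) argo
qed

text \<open>Applying \<open>sunflower_forced_color\<close> at \<open>a1\<close> and, with the other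
  two petals exchanged, at \<open>a2\<close> gives two edges that extend \<open>{z, a1, a2}\<close>
  to a rainbow path.\<close>

lemma no_rainbow_sunflower:
  assumes d: "distinct [z, a1, a2, b1, b2, d1, d2]"
    and V: "{z, a1, a2, b1, b2, d1, d2} \<subseteq> V"
    and c: "c {z, a1, a2} \<noteq> c {z, b1, b2}" "c {z, a1, a2} \<noteq> c {z, d1, d2}"
      "c {z, b1, b2} \<noteq> c {z, d1, d2}"
  shows False
proof -
  have 1: "c {a1, d1, d2} = c {z, b1, b2}"
    using sunflower_forced_color[of z a1 a2 b1 b2 d1 d2] d V c by simp
  have 2: "c {a2, b1, b2} = c {z, d1, d2}"
    using sunflower_forced_color[of z a2 a1 d1 d2 b1 b2] d V c by (simp add: insert_commute) argo
  show False
    using path_free[of d1 d2 a1 z a2 b1 b2] 1 2 d V c by (simp add: insert_commute) argo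
qed

text \<open>The position of \<open>g\<close> decides: disjoint from both edges, it gives the pair
  with a disjoint edge; meeting exactly one, a loose path; meeting both, a sunflower or a triangle,
  according to whether it contains \<open>r\<close>.\<close>

lemma no_rainbow_triple_meeting:
  assumes E: "e \<in> E" "f \<in> E" "g \<in> E" and c: "c e \<noteq> c f" "c e \<noteq> c g" "c f \<noteq> c g"
    and ef: "card (e \<inter> f) = 1" and eg: "card (e \<inter> g) \<le> 1" and fg: "card (f \<inter> g) \<le> 1"
  shows False
proof -
  have V: "e \<subseteq> V" "f \<subseteq> V" "g \<subseteq> V" and three: "card e = 3" "card f = 3" "card g = 3"
    using E by (auto simp: E_def)
  have fin: "finite (e \<inter> g)" "finite (f \<inter> g)"
    using V finite_V by (auto intro: finite_subset)
  obtain r where r: "e \<inter> f = {r}" using ef by (auto simp: card_1_singleton_iff)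
  consider "e \<inter> g = {}" "f \<inter> g = {}" | p where "e \<inter> g = {p}" "f \<inter> g = {}"
    | t where "e \<inter> g = {}" "f \<inter> g = {t}" | p t where "e \<inter> g = {p}" "f \<inter> g = {t}"
  proof -
    have "e \<inter> g = {} \<or> (\<exists>p. e \<inter> g = {p})" "f \<inter> g = {} \<or> (\<exists>t. f \<inter> g = {t})"
      using eg fg fin by (auto simp: le_Suc_eq card_1_singleton_iff)
    then show thesis using that by blast
  qed
  then show False
  proof cases
    case 1
    obtain p q where e: "e = {p, q, r}" "p \<noteq> q" "p \<noteq> r" "q \<noteq> r"
      using card_3_obtain_rest[OF three(1), of r] r by blast
    obtain s t where f: "f = {s, t, r}" "s \<noteq> t" "s \<noteq> r" "t \<noteq> r"
      using card_3_obtain_rest[OF three(2), of r] r by blast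
    obtain u v w where g: "g = {u, v, w}" "u \<noteq> v" "u \<noteq> w" "v \<noteq> w"
      using three(3) by (auto simp: card_3_iff)
    have "distinct [p, q, r, s, t, u, v, w]" using e f g 1 r by auto
    moreover have "{p, q, r, s, t, u, v, w} \<subseteq> V" using e f g V by auto
    ultimately show False
      using no_rainbow_pair_and_disjoint[of p q r s t u v w] c unfolding e(1) f(1) g(1)
      by (simp add: insert_commute)
  next
    case (2 p)
    then have *: "p \<noteq> r" "p \<in> e" "p \<in> g" "r \<in> e" "r \<in> f" using r by auto
    obtain q where e: "e = {p, q, r}" "q \<noteq> p" "q \<noteq> r"
      using card_3_obtain_third[OF three(1)] * by blast
    obtain s t where f: "f = {s, t, r}" "s \<noteq> t" "s \<noteq> r" "t \<noteq> r"
      using card_3_obtain_rest[OF three(2)] * by blast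
    obtain u v where g: "g = {u, v, p}" "u \<noteq> v" "u \<noteq> p" "v \<noteq> p"
      using card_3_obtain_rest[OF three(3)] * by blast
    have "distinct [u, v, p, q, r, s, t]" using e f g 2 r * by auto
    moreover have "{u, v, p, q, r, s, t} \<subseteq> V" using e f g V by auto
    ultimately show False
      using path_free[of u v p q r s t] c unfolding e(1) f(1) g(1)
      by (simp only: insert_commute) metis
  next
    case (3 p)
    then have *: "p \<noteq> r" "p \<in> f" "p \<in> g" "r \<in> e" "r \<in> f" using r by auto
    obtain q where f: "f = {p, q, r}" "q \<noteq> p" "q \<noteq> r"
      using card_3_obtain_third[OF three(2)] * by blast
    obtain s t where e: "e = {s, t, r}" "s \<noteq> t" "s \<noteq> r" "t \<noteq> r"
      using card_3_obtain_rest[OF three(1)] * by blast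
    obtain u v where g: "g = {u, v, p}" "u \<noteq> v" "u \<noteq> p" "v \<noteq> p"
      using card_3_obtain_rest[OF three(3)] * by blast
    have "distinct [u, v, p, q, r, s, t]" using e f g 3 r * by auto
    moreover have "{u, v, p, q, r, s, t} \<subseteq> V" using e f g V by auto
    ultimately show False
      using path_free[of u v p q r s t] c unfolding e(1) f(1) g(1)
      by (simp only: insert_commute) metis
  next
    case (4 p t)
    show False
    proof (cases "r \<in> g")
      case True
      then have *: "r \<in> e" "r \<in> f" "p = r" "t = r" using r 4 by auto
      obtain a1 a2 where e: "e = {a1, a2, r}" "a1 \<noteq> a2" "a1 \<noteq> r" "a2 \<noteq> r"
        using card_3_obtain_rest[OF three(1)] * by blast
      obtain b1 b2 where f: "f = {b1, b2, r}" "b1 \<noteq> b2" "b1 \<noteq> r" "b2 \<noteq> r"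
        using card_3_obtain_rest[OF three(2)] * by blast
      obtain d1 d2 where g: "g = {d1, d2, r}" "d1 \<noteq> d2" "d1 \<noteq> r" "d2 \<noteq> r"
        using card_3_obtain_rest[OF three(3)] True by blast
      have only: "x = r" if "x \<in> e \<inter> f \<or> x \<in> e \<inter> g \<or> x \<in> f \<inter> g" for x
        using that r 4 * by simp
      have "a1 \<in> e" "a2 \<in> e" "b1 \<in> f" "b2 \<in> f" using e(1) f(1) by simp_all
      then have "a1 \<notin> f" "a2 \<notin> f" "a1 \<notin> g" "a2 \<notin> g" "b1 \<notin> g" "b2 \<notin> g"
        using only e(3,4) f(3,4) by blast+
      then have "distinct [r, a1, a2, b1, b2, d1, d2]"
        using e(2-) f(2-) g(2-) unfolding f(1) g(1) by auto
      moreover have "{r, a1, a2, b1, b2, d1, d2} \<subseteq> V" using e f g V by auto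
      ultimately show False
        using no_rainbow_sunflower[of r a1 a2 b1 b2 d1 d2] c unfolding e(1) f(1) g(1)
        by (simp add: insert_commute)
    next
      case False
      then have *: "p \<noteq> r" "t \<noteq> r" "p \<noteq> t" "p \<in> e" "p \<in> g" "t \<in> f" "t \<in> g" "r \<in> e" "r \<in> f"
        using r 4 by auto
      obtain q where e: "e = {p, q, r}" "q \<noteq> p" "q \<noteq> r"
        using card_3_obtain_third[OF three(1)] * by blast
      obtain s where f: "f = {r, s, t}" "s \<noteq> r" "s \<noteq> t"
        using card_3_obtain_third[OF three(2), of r t] * by blast
      obtain u where g: "g = {p, u, t}" "u \<noteq> p" "u \<noteq> t"
        using card_3_obtain_third[OF three(3)] * by blast
      \<comment> \<open>A triangle spans six vertices; the spare seventh exists because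
        \<open>7 \<le> card V\<close>.\<close>
      obtain w where w: "w \<in> V" "w \<notin> set [p, q, r, s, t, u]"
        using obtain_outside[of "[p, q, r, s, t, u]"] by auto
      have "distinct [p, q, r, s, t, u, w]" using e f g w 4 r * by auto
      moreover have "{p, q, r, s, t, u, w} \<subseteq> V" using e f g w V by auto
      ultimately show False
        using no_rainbow_triangle[of p q r s t u w] c unfolding e(1) f(1) g(1)
        by (simp add: insert_commute)
    qed
  qed
qed

lemma no_rainbow_triple:
  assumes E: "e \<in> E" "f \<in> E" "g \<in> E" and c: "c e \<noteq> c f" "c e \<noteq> c g" "c f \<noteq> c g"
    and m: "card (e \<inter> f) \<le> 1" "card (e \<inter> g) \<le> 1" "card (f \<inter> g) \<le> 1"
  shows False
proof -
  have V: "e \<subseteq> V" "f \<subseteq> V" "g \<subseteq> V" and three: "card e = 3" "card f = 3" "card g = 3"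
    using E by (auto simp: E_def)
  have fin: "finite e" "finite f" using V finite_V by (auto intro: finite_subset)
  have "card (e \<inter> f) \<noteq> 1" using no_rainbow_triple_meeting[OF E c] m by blast
  moreover have "card (e \<inter> g) \<noteq> 1"
    using no_rainbow_triple_meeting[of e g f] E c m by (auto simp: Int_commute)
  moreover have "card (f \<inter> g) \<noteq> 1"
    using no_rainbow_triple_meeting[of f g e] E c m by (auto simp: Int_commute)
  ultimately have disj: "e \<inter> f = {}" "e \<inter> g = {}" "f \<inter> g = {}"
    using m fin by (auto simp: le_Suc_eq)
  obtain a1 a2 a3 where e: "e = {a1, a2, a3}" "a1 \<noteq> a2" "a1 \<noteq> a3" "a2 \<noteq> a3"
    using three(1) by (auto simp: card_3_iff)
  obtain b1 b2 b3 where f: "f = {b1, b2, b3}" "b1 \<noteq> b2" "b1 \<noteq> b3" "b2 \<noteq> b3"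
    using three(2) by (auto simp: card_3_iff)
  obtain d1 d2 d3 where g: "g = {d1, d2, d3}" "d1 \<noteq> d2" "d1 \<noteq> d3" "d2 \<noteq> d3"
    using three(3) by (auto simp: card_3_iff)
  have "distinct [a1, a2, a3, b1, b2, b3, d1, d2, d3]" using e f g disj by auto
  moreover have "{a1, a2, a3, b1, b2, b3, d1, d2, d3} \<subseteq> V" using e f g V by auto
  ultimately show False
    by (rule no_rainbow_disjoint_triple[OF _ _ c[unfolded e(1) f(1) g(1)]])
qed

section \<open>Spreading a colour away from a close pair\<close>

lemma E_finite: "e \<in> E \<Longrightarrow> finite e"
  using finite_V by (auto simp: E_def intro: finite_subset)

lemma E_card_Int:
  assumes "e \<in> E" "f \<in> E" "e \<noteq> f"
  shows "card (e \<inter> f) \<le> 2"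
proof -
  have "\<not> e \<subseteq> f"
    using card_subset_eq[OF E_finite[OF assms(2)], of e] assms by (auto simp: E_def)
  then have "e \<inter> f \<subset> e" by auto
  then have "card (e \<inter> f) < card e" using psubset_card_mono E_finite assms(1) by blast
  then show ?thesis using assms(1) by (simp add: E_def)
qed

text \<open>The colour of \<open>e\<close> travels along chains of edges in which consecutive
  members share at most one vertex: from \<open>e\<close> to a triple \<open>D\<close> outside
  \<open>f \<union> g\<close>, then through some \<open>{a, b, w}\<close> to
  \<open>h\<close>.\<close>

lemma dominant_color_outside:
  assumes E: "e \<in> E" "f \<in> E" "g \<in> E" and c: "c e \<noteq> c f" "c e \<noteq> c g" "c f \<noteq> c g"
    and fg: "card (f \<inter> g) = 2" and ef: "card (e \<inter> f) \<le> 1" and eg: "card (e \<inter> g) \<le> 1"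
  shows "\<exists>D\<in>E. D \<inter> (f \<union> g) = {}"
    and "\<And>h. \<lbrakk>h \<in> E; 2 \<le> card (h - (f \<union> g))\<rbrakk> \<Longrightarrow> c h = c e"
proof -
  note fin = E_finite[OF E(1)] E_finite[OF E(2)] E_finite[OF E(3)]
  define W where "W = V - (f \<union> g)"
  have finW: "finite W" using finite_V by (simp add: W_def)
  have "card (f \<union> g) = 4"
    using card_Un_Int[of f g] fin fg E by (simp add: E_def)
  then have W3: "card W \<ge> 3"
    using card_V card_Diff_subset[of "f \<union> g" V] fin E by (auto simp: W_def E_def)
  have "card (f \<inter> g) < card f" "card (f \<inter> g) < card g" using fg E by (auto simp: E_def)
  then obtain a b where a: "a \<in> f" "a \<notin> g" and b: "b \<in> g" "b \<notin> f"
    by (metis Int_absorb1 Int_absorb2 nat_neq_iff subsetI)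
  obtain D where D: "D \<subseteq> W" "card D = 3" using obtain_subset_with_card_n[OF W3] by blast
  have DE: "D \<in> E" using D by (auto simp: E_def W_def)
  show "\<exists>D\<in>E. D \<inter> (f \<union> g) = {}" using DE D by (auto simp: W_def)
  \<comment> \<open>Good edges are close to neither \<open>f\<close> nor \<open>g\<close>. If
    \<open>m\<close> and \<open>h\<close> are good and non-close and \<open>m\<close> has the colour
    of \<open>e\<close>, the triple with \<open>f\<close> allows \<open>h\<close> only the colours
    of \<open>e\<close> and \<open>f\<close>, the triple with \<open>g\<close> only those of
    \<open>e\<close> and \<open>g\<close>.\<close>
  define good where "good h \<longleftrightarrow> h \<in> E \<and> card (h \<inter> f) \<le> 1 \<and> card (h \<inter> g) \<le> 1" for h
  have step: "c h = c e" if "good m" "c m = c e" "good h" "card (m \<inter> h) \<le> 1" for m h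
    using no_rainbow_triple[of m f h] no_rainbow_triple[of m g h] that c E
    by (simp add: good_def Int_commute) metis
  have good_abw: "good {a, b, w}" if "w \<in> W" for w
  proof -
    have "{a, b, w} \<inter> f = {a}" "{a, b, w} \<inter> g = {b}" using that a b by (auto simp: W_def)
    moreover have "a \<noteq> b" "a \<noteq> w" "b \<noteq> w" using that a b by (auto simp: W_def)
    then have "{a, b, w} \<in> E" using that a b E by (auto simp: W_def E_def)
    ultimately show ?thesis by (simp add: good_def)
  qed
  have outside_le: "card (h - W) \<le> 1" if "h \<in> E" "2 \<le> card (h \<inter> W)" for h
  proof -
    have "card h = 3" using that(1) by (simp add: E_def)
    then show ?thesis using card_Int_Diff[OF E_finite[OF that(1)], of W] that(2) by linarith
  qed
  have good_big: "good h" if "h \<in> E" "2 \<le> card (h \<inter> W)" for h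
  proof -
    have "card (h \<inter> f) \<le> card (h - W)" "card (h \<inter> g) \<le> card (h - W)"
      using E_finite[OF that(1)] by (auto intro!: card_mono simp: W_def)
    then show ?thesis using outside_le[OF that] that(1) by (simp add: good_def)
  qed
  \<comment> \<open>If \<open>h\<close> lies in \<open>W\<close> it misses \<open>a\<close> and
    \<open>b\<close>. Otherwise it has a single vertex outside \<open>W\<close>, and since
    \<open>W\<close> has at least three vertices, some \<open>w\<close> avoids
    \<open>h\<close>.\<close>
  have pick: "\<exists>w\<in>W. card (h \<inter> {a, b, w}) \<le> 1" if h: "h \<in> E" "2 \<le> card (h \<inter> W)" for h
  proof (cases "h \<subseteq> W")
    case True
    obtain w where w: "w \<in> W" using W3 by fastforce
    have "h \<inter> {a, b, w} \<subseteq> {w}" using True a b by (auto simp: W_def)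
    then have "card (h \<inter> {a, b, w}) \<le> card {w}" by (intro card_mono) auto
    then show ?thesis using w by auto
  next
    case False
    have "\<not> W \<subseteq> h"
    proof
      assume "W \<subseteq> h"
      then have "W \<subset> h" using False by auto
      then have "card W < card h" using psubset_card_mono E_finite h(1) by blast
      then show False using W3 h(1) by (simp add: E_def)
    qed
    then obtain w where w: "w \<in> W" "w \<notin> h" by blast
    have "h \<inter> {a, b, w} \<subseteq> h - W" using w a b by (auto simp: W_def)
    then have "card (h \<inter> {a, b, w}) \<le> card (h - W)"
      using E_finite[OF h(1)] by (intro card_mono) auto
    then show ?thesis using w outside_le[OF h] by (intro bexI[of _ w]) auto
  qed
  have D_abw: "card (D \<inter> {a, b, w}) \<le> 1" for w
  proof -
    have "D \<inter> {a, b, w} \<subseteq> {w}" using D a b by (auto simp: W_def)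
    then have "card (D \<inter> {a, b, w}) \<le> card {w}" by (intro card_mono) auto
    then show ?thesis by simp
  qed
  have good_D: "good D" using good_big[OF DE] D by (simp add: Int_absorb2)
  have good_e: "good e" using E ef eg by (simp add: good_def)
  \<comment> \<open>With two vertices of \<open>e\<close> in \<open>W\<close>, some
    \<open>{a, b, w}\<close> mediates between \<open>e\<close> and \<open>D\<close>; otherwise
    \<open>e\<close> and \<open>D\<close> are already non-close.\<close>
  have cD: "c D = c e"
  proof (cases "2 \<le> card (e \<inter> W)")
    case True
    then obtain w where w: "w \<in> W" "card (e \<inter> {a, b, w}) \<le> 1" using pick[OF E(1)] by blast
    have "c {a, b, w} = c e" using step[OF good_e refl good_abw] w by blast
    then show ?thesis
      using step[OF good_abw _ good_D] w(1) D_abw[of w] by (simp add: Int_commute)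
  next
    case False
    have "card (e \<inter> D) \<le> card (e \<inter> W)" using D finW by (intro card_mono) auto
    then show ?thesis using step[OF good_e refl good_D] False by simp
  qed
  show "c h = c e" if h: "h \<in> E" "2 \<le> card (h - (f \<union> g))" for h
  proof -
    have "h - (f \<union> g) = h \<inter> W" using h(1) by (auto simp: W_def E_def)
    then have hW: "2 \<le> card (h \<inter> W)" using h(2) by simp
    obtain w where w: "w \<in> W" "card (h \<inter> {a, b, w}) \<le> 1" using pick[OF h(1) hW] by blast
    have "c {a, b, w} = c e" using step[OF good_D cD good_abw] w(1) D_abw by blast
    then show ?thesis
      using step[OF good_abw _ good_big[OF h(1) hW]] w by (simp add: Int_commute)
  qed
qed

text \<open>This supplies the configuration for \<open>dominant_color_outside\<close>. A new edge is
  needed only when \<open>g\<close> is close to both \<open>e\<close> and \<open>f\<close>.\<close>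

lemma obtain_conflict_with_close_pair:
  assumes E: "e \<in> E" "f \<in> E" "g \<in> E" and c: "c e \<noteq> c f" "c e \<noteq> c g" "c f \<noteq> c g"
    and ef: "card (e \<inter> f) \<le> 1"
  shows "\<exists>e\<in>E. \<exists>f\<in>E. \<exists>g\<in>E. c e \<noteq> c f \<and> c e \<noteq> c g \<and> c f \<noteq> c g \<and>
    card (f \<inter> g) = 2 \<and> card (e \<inter> f) \<le> 1 \<and> card (e \<inter> g) \<le> 1"
proof -
  have le2: "card (e \<inter> g) \<le> 2" "card (f \<inter> g) \<le> 2" using E_card_Int E c by metis+
  consider "card (e \<inter> g) \<le> 1" "card (f \<inter> g) \<le> 1" | "card (e \<inter> g) \<le> 1" "card (f \<inter> g) = 2"
    | "card (e \<inter> g) = 2" "card (f \<inter> g) \<le> 1" | "card (e \<inter> g) = 2" "card (f \<inter> g) = 2"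
    using le2 by linarith
  then show ?thesis
  proof cases
    case 1
    then show ?thesis using no_rainbow_triple E c ef by blast
  next
    case 2
    then show ?thesis using E c ef by blast
  next
    case 3
    then have "card (f \<inter> e) \<le> 1" using ef by (simp add: Int_commute)
    then show ?thesis using 3 E c by metis
  next
    case 4
    have three: "card e = 3" "card f = 3" "card g = 3" and V: "e \<subseteq> V" "f \<subseteq> V" "g \<subseteq> V"
      using E by (auto simp: E_def)
    obtain r where r: "r \<in> e" "r \<in> f" "r \<in> g"
      using two_pairs_in_triple_meet[OF three(3), of e f] 4 by (auto simp: Int_commute)
    have "card (e \<inter> f) = 1"
      using ef r E_finite[OF E(1)] by (metis IntI card_0_eq empty_iff finite_Int le_neq_implies_less less_one)
    then have ef_r: "e \<inter> f = {r}"
      using r by (metis IntI card_1_singletonE singletonD)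
    have "f \<inter> g \<noteq> {r}" using 4 by auto
    then obtain b where b: "b \<in> f" "b \<in> g" "b \<noteq> r" using r by blast
    obtain s where f: "f = {b, s, r}" "s \<noteq> b" "s \<noteq> r"
      using card_3_obtain_third[OF three(2)] b r by blast
    obtain p q where e: "e = {p, q, r}" "p \<noteq> q" "p \<noteq> r" "q \<noteq> r"
      using card_3_obtain_rest[OF three(1)] r by blast
    obtain w where w: "w \<in> V" "w \<notin> set [p, q, r, s, b]"
      using obtain_outside[of "[p, q, r, s, b]"] by auto
    obtain v where v: "v \<in> V" "v \<notin> set [p, q, r, s, b, w]"
      using obtain_outside[of "[p, q, r, s, b, w]"] by auto
    have dist: "distinct [v, w, b, s, r, p, q]" using e f w v ef_r b by auto
    have sub: "{v, w, b, s, r, p, q} \<subseteq> V" using e f w v V by auto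
    define t where "t = {v, w, b}"
    have tE: "t \<in> E" using dist sub by (auto simp: t_def E_def)
    \<comment> \<open>The vertices \<open>b\<close>, \<open>r\<close> and a second vertex of
      \<open>e\<close> exhaust \<open>g\<close>, so the fresh vertices \<open>v\<close>,
      \<open>w\<close> lie outside \<open>g\<close>.\<close>
    have "e \<inter> g \<noteq> {r}" using 4 by auto
    then have "g \<subseteq> e \<union> f"
      using b r three(3) ef_r by (auto elim!: card_3_obtain_third[of g b r])
    then have "t \<inter> g \<subseteq> {b}" using dist e f by (auto simp: t_def)
    then have tg: "card (t \<inter> g) \<le> 1" using card_mono[of "{b}" "t \<inter> g"] by auto
    have "t \<inter> f = {b}" "t \<inter> e = {}" using dist e f by (auto simp: t_def)
    then have tf: "card (t \<inter> f) \<le> 1" and te: "card (t \<inter> e) \<le> 1" by auto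
    \<comment> \<open>The edges \<open>t\<close>, \<open>f\<close>, \<open>e\<close> form a loose
      path. Whichever of \<open>e\<close>, \<open>f\<close> shares its colour with \<open>t\<close>
      is replaced by \<open>t\<close>, and the other one stays close to \<open>g\<close>.\<close>
    have "c t = c e \<or> c t = c f"
      using path_free[OF dist sub] c(1) unfolding t_def e(1) f(1)
      by (simp add: insert_commute) argo
    then show ?thesis
    proof
      assume "c t = c e"
      then show ?thesis using tE E c 4 tf tg by metis
    next
      assume "c t = c f"
      then show ?thesis using tE E c 4 te tg by metis
    qed
  qed
qed

section \<open>The two alternatives\<close>

text \<open>If some non-close edges differ in colour, the dominant colour serves as
  \<open>i\<close>, and \<open>D\<close> would complete any non-close \<open>h\<close>,
  \<open>k\<close> to a forbidden triple. Otherwise any colour serves.\<close>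

lemma exists_central_color:
  assumes "card (c ` E) \<ge> 3"
  shows "\<exists>i \<in> c ` E. \<forall>h\<in>E. \<forall>k\<in>E. c h \<noteq> i \<longrightarrow> c k \<noteq> i \<longrightarrow> c h \<noteq> c k \<longrightarrow> card (h \<inter> k) = 2"
proof (cases "\<exists>e\<in>E. \<exists>f\<in>E. c e \<noteq> c f \<and> card (e \<inter> f) \<le> 1")
  case True
  then obtain e f where ef: "e \<in> E" "f \<in> E" "c e \<noteq> c f" "card (e \<inter> f) \<le> 1" by blast
  have "\<not> c ` E \<subseteq> {c e, c f}"
    using assms card_mono[of "{c e, c f}" "c ` E"] ef(3) by auto
  then obtain g where g: "g \<in> E" "c e \<noteq> c g" "c f \<noteq> c g" by (metis image_subsetI insertCI)
  obtain e' f' g' where *: "e' \<in> E" "f' \<in> E" "g' \<in> E" "c e' \<noteq> c f'" "c e' \<noteq> c g'" "c f' \<noteq> c g'"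
    "card (f' \<inter> g') = 2" "card (e' \<inter> f') \<le> 1" "card (e' \<inter> g') \<le> 1"
    using obtain_conflict_with_close_pair[OF ef(1,2) g(1) ef(3) g(2,3) ef(4)] by blast
  note dom = dominant_color_outside[OF *]
  obtain D where D: "D \<in> E" "D \<inter> (f' \<union> g') = {}" using dom(1) by blast
  then have "D - (f' \<union> g') = D" by auto
  then have cD: "c D = c e'" using dom(2)[OF D(1)] D(1) by (simp add: E_def)
  \<comment> \<open>The set \<open>D\<close> meets \<open>h\<close> only outside
    \<open>f' \<union> g'\<close>, where two vertices of \<open>h\<close> would force the colour of
    \<open>e'\<close>.\<close>
  have DI: "card (D \<inter> h) \<le> 1" if "h \<in> E" "c h \<noteq> c e'" for h
  proof -
    have "card (D \<inter> h) \<le> card (h - (f' \<union> g'))"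
      using D(2) E_finite[OF that(1)] by (intro card_mono) auto
    then show ?thesis using dom(2)[OF that(1)] that(2) by force
  qed
  have "card (h \<inter> k) = 2" if "h \<in> E" "k \<in> E" "c h \<noteq> c e'" "c k \<noteq> c e'" "c h \<noteq> c k" for h k
  proof -
    have "\<not> card (h \<inter> k) \<le> 1"
      using no_rainbow_triple[of D h k] D(1) cD that DI by auto
    moreover have "card (h \<inter> k) \<le> 2" using E_card_Int that by blast
    ultimately show ?thesis by simp
  qed
  then show ?thesis using *(1) by blast
next
  case False
  have "card (h \<inter> k) = 2" if "h \<in> E" "k \<in> E" "c h \<noteq> c k" for h k
  proof -
    have "\<not> card (h \<inter> k) \<le> 1" using False that by blast
    moreover have "card (h \<inter> k) \<le> 2" using E_card_Int that by blast
    ultimately show ?thesis by simp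
  qed
  moreover obtain i where "i \<in> c ` E" using assms by fastforce
  ultimately show ?thesis by blast
qed

lemma vertex_or_edge_structure:
  assumes "card (c ` E) \<ge> 3"
  shows "(\<exists>u\<in>V. \<exists>i. \<forall>e\<in>E. u \<notin> e \<longrightarrow> c e = i) \<or>
    (\<exists>e\<in>E. \<exists>i \<in> c ` E. c e \<noteq> i \<and> (\<forall>f\<in>E - {e}. c f \<noteq> i \<longrightarrow> card (f \<inter> e) = 2))"
proof -
  obtain i where i: "i \<in> c ` E"
    and cross: "\<And>h k. \<lbrakk>h \<in> E; k \<in> E; c h \<noteq> i; c k \<noteq> i; c h \<noteq> c k\<rbrakk> \<Longrightarrow> card (h \<inter> k) = 2"
    using exists_central_color[OF assms] by blast
  have another: "\<exists>r\<in>E. c r \<noteq> i \<and> c r \<noteq> j" for j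
  proof -
    have "\<not> c ` E \<subseteq> {i, j}"
    proof
      assume "c ` E \<subseteq> {i, j}"
      then have "card (c ` E) \<le> card {i, j}" by (intro card_mono) auto
      also have "\<dots> \<le> 2" by (simp add: card_insert_if)
      finally show False using assms by simp
    qed
    then show ?thesis by auto
  qed
  \<comment> \<open>An edge without a non-close partner in its own class witnesses the second
    alternative, since the other classes are close to it by \<open>cross\<close>.\<close>
  have universal: ?thesis if r: "r \<in> E" "c r \<noteq> i"
    and all: "\<And>f. \<lbrakk>f \<in> E; c f \<noteq> i; c f = c r\<rbrakk> \<Longrightarrow> \<not> card (f \<inter> r) \<le> 1" for r
  proof -
    have "card (f \<inter> r) = 2" if f: "f \<in> E" "f \<noteq> r" "c f \<noteq> i" for f
    proof (cases "c f = c r")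
      case True
      then show ?thesis using all[OF f(1,3)] E_card_Int[OF f(1) r(1) f(2)] by linarith
    next
      case False
      then show ?thesis using cross f r by blast
    qed
    then show ?thesis using r i by blast
  qed
  show ?thesis
  proof (rule ccontr)
    assume neg: "\<not> ?thesis"
    have partner: "\<exists>f\<in>E. c f = c r \<and> card (f \<inter> r) \<le> 1" if "r \<in> E" "c r \<noteq> i" for r
      using universal[OF that] neg by blast
    obtain p where p: "p \<in> E" "c p \<noteq> i" using another by blast
    then obtain q where q: "q \<in> E" "c q = c p" "card (q \<inter> p) \<le> 1" using partner by blast
    obtain r where r: "r \<in> E" "c r \<noteq> i" "c r \<noteq> c p" using another by blast
    then obtain s where s: "s \<in> E" "c s = c r" "card (s \<inter> r) \<le> 1" using partner by blast
    have meet: "h \<inter> k \<inter> l \<noteq> {}"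
      if "h \<in> E" "k \<in> E" "l \<in> E" "c h \<noteq> i" "c k \<noteq> i" "c l \<noteq> i" "c h \<noteq> c k" "c h \<noteq> c l" for h k l
      using two_pairs_in_triple_meet[of h k l] cross[of h k] cross[of h l] that
      by (auto simp: E_def)
    obtain a where a: "a \<in> r" "a \<in> p" "a \<in> q" using meet[of r p q] p q r by auto
    have pq: "p \<inter> q \<subseteq> {a}"
      using a q(3) card_le_Suc0_iff_eq[of "q \<inter> p"] E_finite[OF p(1)] by auto
    have other: "a \<in> h" if "h \<in> E" "c h \<noteq> i" "c h \<noteq> c p" for h
      using meet[of h p q] that p q pq by auto
    \<comment> \<open>Both \<open>r\<close> and \<open>s\<close> contain \<open>a\<close>, so the
      argument can be repeated with them in place of \<open>p\<close> and \<open>q\<close>; this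
      reaches the edges coloured like \<open>p\<close>.\<close>
    have rs: "r \<inter> s \<subseteq> {a}"
      using other[OF r] other[of s] r s card_le_Suc0_iff_eq[of "s \<inter> r"] E_finite[OF r(1)] by auto
    have "a \<in> h" if "h \<in> E" "c h \<noteq> i" for h
    proof (cases "c h = c p")
      case True
      then show ?thesis using meet[of h r s] that r s rs by auto
    qed (use other that in blast)
    moreover have "a \<in> V" using a p by (auto simp: E_def)
    ultimately show False using neg by blast
  qed
qed

end

section \<open>From vertex lists to copies of the loose path\<close>

lemma loose_path_is_copy:
  fixes V :: "'a set"
  assumes d: "distinct [p, q, r, s, t, u, v]" and V: "{p, q, r, s, t, u, v} \<subseteq> V"
  shows "is_copy loose_path ({p, q, r, s, t, u, v}, {{p, q, r}, {r, s, t}, {t, u, v}})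
    (complete_hypergraph 3 V)"
proof -
  \<comment> \<open>The shift by one reconciles the vertices \<open>{1..7}\<close> with list
    positions starting at 0.\<close>
  define \<phi> where "\<phi> k = [p, q, r, s, t, u, v] ! (k - 1)" for k :: nat
  have I: "{1..7::nat} = {1, 2, 3, 4, 5, 6, 7}" by auto
  have \<phi>: "\<phi> 1 = p" "\<phi> 2 = q" "\<phi> 3 = r" "\<phi> 4 = s" "\<phi> 5 = t" "\<phi> 6 = u" "\<phi> 7 = v"
    by (simp_all add: \<phi>_def)
  have "inj_on \<phi> {1..7}"
    unfolding \<phi>_def by (rule inj_onI) (use d in \<open>auto simp: nth_eq_iff_index_eq simp del: distinct.simps\<close>)
  moreover have "\<phi> ` {1..7} = {p, q, r, s, t, u, v}" unfolding I by (simp only: image_insert image_empty \<phi>)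
  ultimately have "bij_betw \<phi> {1..7} {p, q, r, s, t, u, v}" by (simp add: bij_betw_def)
  moreover have "(\<lambda>e. \<phi> ` e) ` {{1, 2, 3}, {3, 4, 5}, {5, 6, 7}} = {{p, q, r}, {r, s, t}, {t, u, v}}"
    by (simp only: image_insert image_empty \<phi>)
  ultimately have "isomorphic loose_path ({p, q, r, s, t, u, v}, {{p, q, r}, {r, s, t}, {t, u, v}})"
    unfolding isomorphic_def loose_path_def by (metis fst_conv snd_conv)
  then show ?thesis
    using d V by (auto simp: is_copy_def subhypergraph_def hypergraph_def complete_hypergraph_def)
qed

theorem theorem1p5:
  fixes V :: "'a set" and n :: nat and G :: "'a hypergraph" and c :: "'a set \<Rightarrow> nat"
  assumes "n \<ge> 7"
    and "finite V" and "card V = n"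
    and "G = complete_hypergraph 3 V"
    and "\<not> (\<exists>P. is_copy loose_path P G \<and> rainbow c P)"
    and "card (colors c G) \<ge> 3"
  shows "(\<exists>u \<in> verts G. monochromatic c (delete_vertex G u)) \<or>
         (\<exists>e \<in> edges G. \<exists>i \<in> colors c G. c e \<noteq> i \<and>
            (\<forall>f \<in> edges G - {e}. c f \<noteq> i \<longrightarrow> card (f \<inter> e) = 2))"
proof -
  have free: "c {p, q, r} = c {r, s, t} \<or> c {r, s, t} = c {t, u, v} \<or> c {p, q, r} = c {t, u, v}"
    if "distinct [p, q, r, s, t, u, v]" "{p, q, r, s, t, u, v} \<subseteq> V" for p q r s t u v
  proof (rule ccontr)
    assume "\<not> ?thesis"
    then have "rainbow c ({p, q, r, s, t, u, v}, {{p, q, r}, {r, s, t}, {t, u, v}})"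
      by (auto simp: rainbow_def)
    then show False using loose_path_is_copy[OF that] assms(4,5) by blast
  qed
  interpret rainbow_loose_path_free V c
    by unfold_locales (use assms(1-3) free in auto)
  have edges: "edges G = E" and verts: "verts G = V"
    using assms(4) by (simp_all add: complete_hypergraph_def E_def)
  have mono: "monochromatic c (delete_vertex G u)" if "\<forall>e\<in>E. u \<notin> e \<longrightarrow> c e = i" for u i
    using that by (auto simp: monochromatic_def delete_vertex_def induced_def edges)
  show ?thesis
    using vertex_or_edge_structure assms(6) mono unfolding colors_def edges verts by meson
qed

end
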